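(* Let $R$ be an execution of Algorithm A (given in the context) that starts in an arbitrary system state. Suppose that there exists a correct processor $p_j$ such that, throughout $R$, $O_j\neq\bot$ is an active multivalued consensus object. Suppose moreover that every correct processor $p_i$ calls $\mathsf{result}_i()$ infinitely often in $R$. Then, within $n$ invocations of binary consensus (i.e., with each correct processor invoking $\mathsf{binPropose}$ on at most $n$ binary consensus objects), the following hold for every correct processor $p_i$: (i) the system reaches a state $c\in R$ after which $\mathsf{result}_i()\neq\bot$ holds; (ii) specifically, $O_i$ is either consistent (as defined in the context) or it eventually reports the occurrence of a transient fault, i.e., $\mathsf{result}_i()=\text{ERR}$.
   Context: **System.** An asynchronous message-passing system has $n$ processors $\mathcal P=\{p_0,\dots,p_{n-1}\}$. At most $t<n/2$ of them crash; $\mathit{Correct}$ is the set of indices of processors that never crash. There are no bounds on delays and no clocks. Channels have bounded capacity and may omit, duplicate and reorder packets. They satisfy fair communication: a message sent infinitely often by $p_i$ to $p_j$ is received infinitely often. An execution is an alternating sequence of system states and atomic steps. A step consists of a local computation followed by a single send or receive. A system state comprises all local variables and channel contents. Arbitrary transient faults may have corrupted the whole state (but not the code) before the execution starts, so the starting state is arbitrary. **Assumed building blocks (both self-stabilizing).** - *Uniform reliable broadcast (URB).* $\mathsf{urbBroadcast}\ m$ returns a descriptor $\mathit{txDes}$. URB-validity: no spontaneous creation or alteration of messages. URB-integrity: no duplication. URB-termination: if the sender is correct, or some processor URB-delivers $m$, then all correct processors URB-deliver $m$. The predicate $\mathsf{hasTerminated}(\mathit{txDes})$ holds once the sender knows that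 all non-failing processors have delivered the message. By URB-termination, it eventually holds at a correct sender. - *Binary consensus objects* $BC[k]$, $k\in\{0,\dots,n-1\}$. $BC[k]=\bot$ means inactive. $\mathsf{binPropose}(k,b)$ with $b\in\{\mathsf{True},\mathsf{False}\}$ activates $BC[k]$ and proposes $b$. $BC[k].\mathsf{result}(k)$ returns $\bot$ if there is no decision yet, and otherwise the decided value. The objects satisfy validity (a decided value was proposed), agreement, integrity (no processor decides twice) and termination (an active object at a correct processor eventually has a decision there). **Algorithm A (code for $p_i$).** There is a single multivalued consensus object $O$ (local copy $O_i$). $O=\bot$ means inactive and $O\ne\bot$ means active. The fields of $O$ are: - $v$, the proposed value; - $\mathit{proposals}[0..n-1]$; - $BC[0..n-1]$, binary consensus objects; - $\mathit{txDes}$; - the Boolean $\mathit{oneTerm}$. The symbol $\bot$ is a special non-value, and ERR (the paper's "transient error" symbol) is another special symbol. Proposable values are different from both. Let $S(x)=\{0,\dots,x\}$ and $\mathsf K=\{k\in S(n-1): O.BC[k]\ne\bot\wedge O.BC[k].\mathsf{result}(k)=\mathsf{False}\}$. Define $\mathsf k()=\max(\{-1\}\cup\{x\in S(n-1): S(x)\subseteq\mathsf K\})$. - $\mathsf{propose}(v)$: if $v\ne\bot$ and $O=\bot$, then $O.(v,\mathit{proposals},BC,\mathit{txDes},\mathit{oneTerm})\gets(v,[\bot,\dots,\bot],[\bot,\dots,\bot],\bot,\mathsf{False})$. - $\mathsf{result}()$, with $k=\mathsf k()$: if $O=\bot$ return $\bot$; else if $O.v=\bot$ or $k\ge n-1$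 return ERR; else if $BC[k+1]=\bot$ or $BC[k+1].\mathsf{result}(k+1)\ne\mathsf{True}$ return $\bot$; else if $O.\mathit{proposals}[k+1]=\bot$ return ERR; else return $O.\mathit{proposals}[k+1]$. - *Do forever*, whenever $O\ne\bot$: (1) if $v\ne\bot$ and ($\mathit{txDes}=\bot$ or $\mathsf{hasTerminated}(\mathit{txDes})$), then set $\mathit{oneTerm}\gets\mathit{oneTerm}\vee(\mathit{txDes}\ne\bot\wedge\mathsf{hasTerminated}(\mathit{txDes}))$ and then $\mathit{txDes}\gets\mathsf{urbBroadcast}\ \mathrm{PROPOSAL}(v)$; (2) use one of two variants. *Sequential*: with $k=\mathsf k()$, if $\mathit{oneTerm}$, $k<n-1$, $BC[k+1]=\bot$ and ($k=-1$ or $BC[k].\mathsf{result}(k)\ne\bot$), then call $\mathsf{binPropose}(k+1,\ \mathit{proposals}[k+1]\ne\bot)$. *Concurrent*: if $\mathit{oneTerm}$ and some $BC[\ell]=\bot$, then for each $k\in\{0,\dots,n-1\}$ with $BC[k]=\bot$ call $\mathsf{binPropose}(k,\ \mathit{proposals}[k]\ne\bot)$. - *Upon URB-delivery of* $\mathrm{PROPOSAL}(v_J)$ *from* $p_j$ with $v_J\ne\bot$: if $O\ne\bot$ and $O.\mathit{proposals}[j]=\bot$, then $O.\mathit{proposals}[j]\gets v_J$; else if $O=\bot$, activate $O$ with $O.(v,\mathit{proposals},BC,\mathit{txDes},\mathit{oneTerm})\gets(v_J,[\bot,\dots,\bot],[\bot,\dots,\bot],\bot,\mathsf{False})$ and then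 $O.\mathit{proposals}[j]\gets v_J$. The statement is for either variant of (2). **Consistency.** $O_i$ is *consistent* in a system state if either $O_i=\bot$, or $O_i\ne\bot$ and, with $k=\mathsf k_i()$, we have $O_i.v\neq\bot$, $k<n-1$, and at least one of the following: $BC[k+1]=\bot$; $BC[k+1].\mathsf{result}(k+1)=\bot$; or $BC[k+1].\mathsf{result}(k+1)=\mathsf{True}$ and $O_i.\mathit{proposals}[k+1]\ne\bot$.
   Formalization: Claim (i) is exempted for p_i exactly when O_i=⊥ throughout R and the given p_j has a corrupted O_j.v=⊥ throughout; there p_j never broadcasts and result_i()=⊥ always, so (i) as stated is false. (ii) is stated for all states from c on. *)

theory Defs
  imports Main
begin

section \<open>Values and local state\<close>

text \<open>
  \<^item> \<open>Bot\<close> is the non-value, \<open>Err\<close> the transient-error symbol.  Every field that holds a value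
    has type \<open>'v sym\<close>, so that a corrupted field may contain any symbol; proposable values are
    the \<open>Val x\<close>.
  \<^item> A binary consensus object is observed through its result (\<open>None\<close>: no decision yet).  In the
    array \<open>bcs\<close>, the entry \<open>None\<close> is an inactive object.
  \<^item> Arrays are total functions; only the indices below \<open>n\<close> are ever accessed.
  \<^item> \<open>'d\<close> is the type of the transmission descriptors of uniform reliable broadcast.
\<close>

datatype 'v sym = Bot | Err | Val 'v

datatype bc = BC (bc_result: "bool option")

record ('v, 'd) mvc =
  val :: "'v sym"
  proposals :: "nat \<Rightarrow> 'v sym"
  bcs :: "nat \<Rightarrow> bc option"
  txDes :: "'d option"
  oneTerm :: bool

datatype variant = Sequential | Concurrent

text \<open>
  The do-forever loop is not atomic: a step performs line (1), or line (2), or one iteration of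
  the for-each loop that the concurrent variant has in line (2).  \<open>ForEach k\<close> is the point of
  that loop at which the index \<open>k\<close> is treated next.
\<close>

datatype pc = Line1 | Line2 | ForEach nat

record ('v, 'd) proc_state =
  obj :: "('v, 'd) mvc option"
  pc :: pc

text \<open>
  \<open>low\<close> stands for everything below the algorithm: the contents of the channels and the local
  variables of the implementations of uniform reliable broadcast and of binary consensus.
\<close>

record ('v, 'd, 'e) sys_state =
  loc :: "nat \<Rightarrow> ('v, 'd) proc_state"
  crashed :: "nat set"
  low :: 'e

section \<open>The algorithm\<close>

definition new_obj :: "'v sym \<Rightarrow> ('v, 'd) mvc" where
  "new_obj v = \<lparr>val = v, proposals = (\<lambda>_. Bot), bcs = (\<lambda>_. None), txDes = None, oneTerm = False\<rparr>"

definition S :: "nat \<Rightarrow> nat set" where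
  "S x = {0..x}"

definition K_set :: "nat \<Rightarrow> ('v, 'd) mvc \<Rightarrow> nat set" where
  "K_set n ob = {k \<in> S (n - 1). \<exists>B. bcs ob k = Some B \<and> bc_result B = Some False}"

definition k_val :: "nat \<Rightarrow> ('v, 'd) mvc \<Rightarrow> int" where
  "k_val n ob = Max ({-1} \<union> {int x |x. x \<in> S (n - 1) \<and> S x \<subseteq> K_set n ob})"

definition result :: "nat \<Rightarrow> ('v, 'd) mvc option \<Rightarrow> 'v sym" where
  "result n Oopt =
     (case Oopt of
        None \<Rightarrow> Bot
      | Some ob \<Rightarrow>
          let k = k_val n ob; k1 = nat (k + 1) in
          if val ob = Bot \<or> k \<ge> int n - 1 then Err
          else case bcs ob k1 of
                 None \<Rightarrow> Bot
               | Some B \<Rightarrow>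
                   if bc_result B \<noteq> Some True then Bot
                   else if proposals ob k1 = Bot then Err
                   else proposals ob k1)"

definition consistent :: "nat \<Rightarrow> ('v, 'd) mvc option \<Rightarrow> bool" where
  "consistent n Oopt =
     (case Oopt of
        None \<Rightarrow> True
      | Some ob \<Rightarrow>
          let k = k_val n ob; k1 = nat (k + 1) in
          val ob \<noteq> Bot \<and> k < int n - 1 \<and>
          (case bcs ob k1 of
             None \<Rightarrow> True
           | Some B \<Rightarrow> bc_result B = None \<or> (bc_result B = Some True \<and> proposals ob k1 \<noteq> Bot)))"

definition propose_eff :: "'v sym \<Rightarrow> ('v, 'd) proc_state \<Rightarrow> ('v, 'd) proc_state" where
  "propose_eff v l = (if v \<noteq> Bot \<and> obj l = None then l\<lparr>obj := Some (new_obj v)\<rparr> else l)"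

definition deliver_eff :: "nat \<Rightarrow> 'v sym \<Rightarrow> ('v, 'd) proc_state \<Rightarrow> ('v, 'd) proc_state" where
  "deliver_eff j v l =
     (if v = Bot then l
      else case obj l of
             None \<Rightarrow> l\<lparr>obj := Some ((new_obj v)\<lparr>proposals := (\<lambda>_. Bot)(j := v)\<rparr>)\<rparr>
           | Some ob \<Rightarrow>
               if proposals ob j = Bot
               then l\<lparr>obj := Some (ob\<lparr>proposals := (proposals ob)(j := v)\<rparr>)\<rparr>
               else l)"

text \<open>
  The calls that the next step of the do-forever loop makes, as a function of the local state:
  \<open>urb_call\<close> is the value broadcast, \<open>bin_call\<close> the arguments of \<open>binPropose\<close>.
  The argument \<open>hT\<close> is the predicate \<open>hasTerminated\<close> at this processor.
\<close>

definition urb_call :: "('d \<Rightarrow> bool) \<Rightarrow> ('v, 'd) proc_state \<Rightarrow> 'v sym option" where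
  "urb_call hT l =
     (case obj l of
        None \<Rightarrow> None
      | Some ob \<Rightarrow>
          if pc l = Line1 \<and> val ob \<noteq> Bot \<and> (case txDes ob of None \<Rightarrow> True | Some d \<Rightarrow> hT d)
          then Some (val ob) else None)"

definition bin_call :: "variant \<Rightarrow> nat \<Rightarrow> ('v, 'd) proc_state \<Rightarrow> (nat \<times> bool) option" where
  "bin_call var n l =
     (case obj l of
        None \<Rightarrow> None
      | Some ob \<Rightarrow>
          (case var of
             Sequential \<Rightarrow>
               let k = k_val n ob; k1 = nat (k + 1) in
               if pc l = Line2 \<and> oneTerm ob \<and> k < int n - 1 \<and> bcs ob k1 = None \<and>
                  (k = -1 \<or> (\<exists>B. bcs ob (nat k) = Some B \<and> bc_result B \<noteq> None))
               then Some (k1, proposals ob k1 \<noteq> Bot) else None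
           | Concurrent \<Rightarrow>
               (case pc l of
                  ForEach k \<Rightarrow>
                    if k < n \<and> bcs ob k = None then Some (k, proposals ob k \<noteq> Bot) else None
                | _ \<Rightarrow> None)))"

definition next_pc :: "variant \<Rightarrow> nat \<Rightarrow> ('v, 'd) proc_state \<Rightarrow> pc" where
  "next_pc var n l =
     (case obj l of
        None \<Rightarrow> Line1
      | Some ob \<Rightarrow>
          (case pc l of
             Line1 \<Rightarrow> Line2
           | Line2 \<Rightarrow>
               if var = Concurrent \<and> oneTerm ob \<and> (\<exists>k<n. bcs ob k = None) then ForEach 0 else Line1
           | ForEach k \<Rightarrow>
               if var = Concurrent \<and> k < n then ForEach (Suc k) else Line1))"

text \<open>\<open>d\<close> is the descriptor returned by \<open>urbBroadcast\<close>; it is ignored when there is no broadcast.\<close>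

definition loop_eff ::
    "variant \<Rightarrow> nat \<Rightarrow> ('d \<Rightarrow> bool) \<Rightarrow> 'd \<Rightarrow> ('v, 'd) proc_state \<Rightarrow> ('v, 'd) proc_state" where
  "loop_eff var n hT d l =
     l\<lparr>pc := next_pc var n l,
       obj := map_option
         (\<lambda>ob. if urb_call hT l \<noteq> None
               then ob\<lparr>oneTerm := oneTerm ob \<or> (\<exists>d'. txDes ob = Some d' \<and> hT d'), txDes := Some d\<rparr>
               else case bin_call var n l of
                      None \<Rightarrow> ob
                    | Some (k, b) \<Rightarrow> ob\<lparr>bcs := (bcs ob)(k := Some (BC None))\<rparr>)
         (obj l)\<rparr>"

definition bc_output_eff :: "nat \<Rightarrow> bool option \<Rightarrow> ('v, 'd) proc_state \<Rightarrow> ('v, 'd) proc_state" where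
  "bc_output_eff k r l =
     l\<lparr>obj := map_option
         (\<lambda>ob. if bcs ob k = None then ob else ob\<lparr>bcs := (bcs ob)(k := Some (BC r))\<rparr>) (obj l)\<rparr>"

section \<open>Executions\<close>

text \<open>
  The first argument is the processor that takes the step.  \<open>Deliver i j d v\<close> is the URB-delivery
  by \<open>i\<close> of \<open>PROPOSAL(v)\<close> from \<open>j\<close>, where \<open>d\<close> is the descriptor of that broadcast.
  \<open>BC_Output i k r\<close> is a step of binary consensus object \<open>k\<close> that sets its result at \<open>i\<close>, and
  \<open>Low i\<close> is any other step of the two underlying implementations.
\<close>

datatype ('v, 'd) action =
    Propose (actor: nat) "'v sym"
  | Result (actor: nat)
  | Loop (actor: nat) 'd
  | Deliver (actor: nat) nat 'd "'v sym"
  | BC_Output (actor: nat) nat "bool option"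
  | Low (actor: nat)
  | Crash (actor: nat)

fun enabled_args :: "nat \<Rightarrow> ('v, 'd) action \<Rightarrow> bool" where
  "enabled_args n (Propose i v) = (v \<noteq> Err)"
| "enabled_args n (Deliver i j d v) = (j < n)"
| "enabled_args n (BC_Output i k r) = (k < n)"
| "enabled_args n _ = True"

fun effect :: "variant \<Rightarrow> nat \<Rightarrow> ('d \<Rightarrow> bool) \<Rightarrow> ('v, 'd) action
    \<Rightarrow> ('v, 'd) proc_state \<Rightarrow> ('v, 'd) proc_state" where
  "effect var n hT (Propose i v) l = propose_eff v l"
| "effect var n hT (Loop i d) l = loop_eff var n hT d l"
| "effect var n hT (Deliver i j d v) l = deliver_eff j v l"
| "effect var n hT (BC_Output i k r) l = bc_output_eff k r l"
| "effect var n hT _ l = l"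

text \<open>
  \<open>hT e i d\<close> is the value of \<open>hasTerminated(d)\<close> at processor \<open>i\<close> when the low-level configuration
  is \<open>e\<close>.  A step may change the low-level configuration in any way; what is known about it is
  stated by \<open>urb_spec\<close> and \<open>bc_spec\<close> below.
\<close>

definition step :: "variant \<Rightarrow> nat \<Rightarrow> ('e \<Rightarrow> nat \<Rightarrow> 'd \<Rightarrow> bool)
    \<Rightarrow> ('v, 'd, 'e) sys_state \<Rightarrow> ('v, 'd) action \<Rightarrow> ('v, 'd, 'e) sys_state \<Rightarrow> bool" where
  "step var n hT s a s' \<longleftrightarrow>
     actor a < n \<and> actor a \<notin> crashed s \<and> enabled_args n a \<and>
     loc s' = (loc s)(actor a := effect var n (hT (low s) (actor a)) a (loc s (actor a))) \<and>
     crashed s' = (case a of Crash i \<Rightarrow> insert i (crashed s) | _ \<Rightarrow> crashed s)"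

text \<open>
  \<open>st 0, act 0, st 1, act 1, \<dots>\<close> alternates states and steps.  The starting state \<open>st 0\<close> is
  not constrained.
\<close>

definition execution :: "variant \<Rightarrow> nat \<Rightarrow> ('e \<Rightarrow> nat \<Rightarrow> 'd \<Rightarrow> bool)
    \<Rightarrow> (nat \<Rightarrow> ('v, 'd, 'e) sys_state) \<Rightarrow> (nat \<Rightarrow> ('v, 'd) action) \<Rightarrow> bool" where
  "execution var n hT st act \<longleftrightarrow> (\<forall>\<tau>. step var n hT (st \<tau>) (act \<tau>) (st (Suc \<tau>)))"

definition Correct :: "nat \<Rightarrow> (nat \<Rightarrow> ('v, 'd, 'e) sys_state) \<Rightarrow> nat set" where
  "Correct n st = {i. i < n \<and> (\<forall>\<tau>. i \<notin> crashed (st \<tau>))}"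

abbreviation O_at :: "(nat \<Rightarrow> ('v, 'd, 'e) sys_state) \<Rightarrow> nat \<Rightarrow> nat \<Rightarrow> ('v, 'd) mvc option" where
  "O_at st \<tau> i \<equiv> obj (loc (st \<tau>) i)"

text \<open>A correct processor executes its do-forever loop forever.\<close>

definition fair_loops ::
    "nat \<Rightarrow> (nat \<Rightarrow> ('v, 'd, 'e) sys_state) \<Rightarrow> (nat \<Rightarrow> ('v, 'd) action) \<Rightarrow> bool" where
  "fair_loops n st act \<longleftrightarrow> (\<forall>i\<in>Correct n st. infinite {\<tau>. \<exists>d. act \<tau> = Loop i d})"

section \<open>Uniform reliable broadcast\<close>

definition urb_broadcasts :: "('e \<Rightarrow> nat \<Rightarrow> 'd \<Rightarrow> bool)
    \<Rightarrow> (nat \<Rightarrow> ('v, 'd, 'e) sys_state) \<Rightarrow> (nat \<Rightarrow> ('v, 'd) action)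
    \<Rightarrow> nat \<Rightarrow> nat \<Rightarrow> 'd \<Rightarrow> 'v sym \<Rightarrow> bool" where
  "urb_broadcasts hT st act \<tau> j d v \<longleftrightarrow>
     act \<tau> = Loop j d \<and> urb_call (hT (low (st \<tau>)) j) (loc (st \<tau>) j) = Some v"

definition has_term :: "('e \<Rightarrow> nat \<Rightarrow> 'd \<Rightarrow> bool)
    \<Rightarrow> (nat \<Rightarrow> ('v, 'd, 'e) sys_state) \<Rightarrow> nat \<Rightarrow> nat \<Rightarrow> 'd \<Rightarrow> bool" where
  "has_term hT st \<tau> i d \<longleftrightarrow> hT (low (st \<tau>)) i d"

text \<open>
  The broadcast is self-stabilizing: before some point \<open>T\<close> of the execution, messages left over
  in the channels may be delivered, messages may be lost, and \<open>hasTerminated\<close> may be wrong.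
  A message is identified by its sender and its descriptor.  The last three clauses say that
  \<open>hasTerminated\<close> is only true of a message that all correct processors have delivered, that it
  stays true as long as the sender does not replace the descriptor, and that it
  eventually becomes true of any descriptor (including a corrupted one) that a correct
  processor holds.
\<close>

definition urb_spec :: "nat \<Rightarrow> ('e \<Rightarrow> nat \<Rightarrow> 'd \<Rightarrow> bool)
    \<Rightarrow> (nat \<Rightarrow> ('v, 'd, 'e) sys_state) \<Rightarrow> (nat \<Rightarrow> ('v, 'd) action) \<Rightarrow> bool" where
  "urb_spec n hT st act \<longleftrightarrow> (\<exists>T.
     \<comment> \<open>validity\<close>
     (\<forall>\<tau>\<ge>T. \<forall>i j d v. act \<tau> = Deliver i j d v \<longrightarrow> (\<exists>\<tau>'<\<tau>. urb_broadcasts hT st act \<tau>' j d v)) \<and>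
     \<comment> \<open>integrity\<close>
     (\<forall>\<tau>\<ge>T. \<forall>\<tau>'\<ge>T. \<forall>i j d v v'.
        act \<tau> = Deliver i j d v \<and> act \<tau>' = Deliver i j d v' \<longrightarrow> \<tau> = \<tau>') \<and>
     \<comment> \<open>termination\<close>
     (\<forall>\<tau>\<ge>T. \<forall>j\<in>Correct n st. \<forall>d v. urb_broadcasts hT st act \<tau> j d v \<longrightarrow>
        (\<forall>i\<in>Correct n st. \<exists>\<tau>'>\<tau>. act \<tau>' = Deliver i j d v)) \<and>
     (\<forall>\<tau>\<ge>T. \<forall>i' j d v. act \<tau> = Deliver i' j d v \<longrightarrow>
        (\<forall>i\<in>Correct n st. \<exists>\<tau>'. act \<tau>' = Deliver i j d v)) \<and>
     \<comment> \<open>\<open>hasTerminated\<close>\<close>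
     (\<forall>\<tau>\<ge>T. \<forall>\<tau>'>\<tau>. \<forall>j d v.
        urb_broadcasts hT st act \<tau> j d v \<and> has_term hT st \<tau>' j d \<longrightarrow>
        (\<forall>i\<in>Correct n st. \<exists>\<tau>''. \<tau> < \<tau>'' \<and> \<tau>'' < \<tau>' \<and> act \<tau>'' = Deliver i j d v)) \<and>
     (\<forall>\<tau>\<ge>T. \<forall>i<n. \<forall>ob d. O_at st \<tau> i = Some ob \<and> txDes ob = Some d \<and> has_term hT st \<tau> i d \<and>
        (\<nexists>d' v. urb_broadcasts hT st act \<tau> i d' v) \<longrightarrow> has_term hT st (Suc \<tau>) i d) \<and>
     (\<forall>\<tau>\<ge>T. \<forall>i\<in>Correct n st. \<forall>ob d. O_at st \<tau> i = Some ob \<and> txDes ob = Some d \<longrightarrow>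
        (\<exists>\<tau>'\<ge>\<tau>. has_term hT st \<tau>' i d)))"

section \<open>Binary consensus\<close>

definition bin_proposes :: "variant \<Rightarrow> nat
    \<Rightarrow> (nat \<Rightarrow> ('v, 'd, 'e) sys_state) \<Rightarrow> (nat \<Rightarrow> ('v, 'd) action)
    \<Rightarrow> nat \<Rightarrow> nat \<Rightarrow> nat \<Rightarrow> bool \<Rightarrow> bool" where
  "bin_proposes var n st act \<tau> i k b \<longleftrightarrow>
     (\<exists>d. act \<tau> = Loop i d) \<and> bin_call var n (loc (st \<tau>) i) = Some (k, b)"

definition bc_active :: "(nat \<Rightarrow> ('v, 'd, 'e) sys_state) \<Rightarrow> nat \<Rightarrow> nat \<Rightarrow> nat \<Rightarrow> bool" where
  "bc_active st \<tau> i k \<longleftrightarrow> (\<exists>ob. O_at st \<tau> i = Some ob \<and> bcs ob k \<noteq> None)"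

definition bc_decided :: "(nat \<Rightarrow> ('v, 'd, 'e) sys_state) \<Rightarrow> nat \<Rightarrow> nat \<Rightarrow> nat \<Rightarrow> bool \<Rightarrow> bool" where
  "bc_decided st \<tau> i k b \<longleftrightarrow>
     (\<exists>ob B. O_at st \<tau> i = Some ob \<and> bcs ob k = Some B \<and> bc_result B = Some b)"

text \<open>
  A binary consensus object that is inactive at every processor in the starting state satisfies
  its full specification in the whole execution.  An object that the transient fault
  left active may show arbitrary, even different, decided values that nobody has proposed, and no
  protocol can repair a decision that was already returned; so validity and agreement cannot
  be required of it.  Self-stabilization gives it termination and, from some
  point on, irrevocable decisions.
\<close>

definition bc_spec :: "variant \<Rightarrow> nat
    \<Rightarrow> (nat \<Rightarrow> ('v, 'd, 'e) sys_state) \<Rightarrow> (nat \<Rightarrow> ('v, 'd) action) \<Rightarrow> bool" where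
  "bc_spec var n st act \<longleftrightarrow> (\<forall>k<n.
     ((\<forall>i<n. \<not> bc_active st 0 i k) \<longrightarrow>
        \<comment> \<open>validity\<close>
        (\<forall>\<tau>. \<forall>i<n. \<forall>b. bc_decided st \<tau> i k b \<longrightarrow>
           (\<exists>\<tau>'<\<tau>. \<exists>j. bin_proposes var n st act \<tau>' j k b)) \<and>
        \<comment> \<open>agreement\<close>
        (\<forall>\<tau> \<tau>'. \<forall>i<n. \<forall>j<n. \<forall>b b'.
           bc_decided st \<tau> i k b \<and> bc_decided st \<tau>' j k b' \<longrightarrow> b = b') \<and>
        \<comment> \<open>integrity\<close>
        (\<forall>\<tau>. \<forall>i<n. \<forall>b. bc_decided st \<tau> i k b \<longrightarrow> bc_decided st (Suc \<tau>) i k b)) \<and>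
     \<comment> \<open>integrity from some point on\<close>
     (\<exists>T. \<forall>\<tau>\<ge>T. \<forall>i<n. \<forall>b. bc_decided st \<tau> i k b \<longrightarrow> bc_decided st (Suc \<tau>) i k b) \<and>
     \<comment> \<open>termination\<close>
     (\<forall>\<tau>. \<forall>i\<in>Correct n st. bc_active st \<tau> i k \<longrightarrow> (\<exists>\<tau>'\<ge>\<tau>. \<exists>b. bc_decided st \<tau>' i k b)))"

end

theory Submission
  imports Defs
begin

text \<open>
  Once \<open>O\<close> is active at a correct processor, every Boolean fact on which \<open>result\<close> and \<open>consistent\<close>
  depend (which objects are active or decided, which proposals are present) is monotone in time,
  from some point on, and hence eventually constant.  In the limit, fairness of the loop together
  with termination of the broadcast and of binary consensus leaves no reason for \<open>result\<close> to be
  \<open>Bot\<close>, and an inconsistency in the limit is permanent and of the kind that \<open>result\<close> reports.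
\<close>

section \<open>The index computed from the decisions\<close>

text \<open>For \<open>0 < n\<close> this is the least index whose object has not decided
  \<open>False\<close>, or \<open>n\<close> if all have. The shift by one avoids the integer
  -1.\<close>

definition first_open :: "nat \<Rightarrow> ('v, 'd) mvc \<Rightarrow> nat" where
  "first_open n ob = nat (k_val n ob + 1)"

lemma k_val_set_finite: "finite ({-1} \<union> {int x |x. x \<in> S (n - 1) \<and> S x \<subseteq> K_set n ob})"
  by (simp add: S_def)

lemma k_val_eq: "k_val n ob = int (first_open n ob) - 1"
proof -
  have "-1 \<le> k_val n ob"
    unfolding k_val_def by (rule Max_ge[OF k_val_set_finite]) simp
  then show ?thesis by (simp add: first_open_def)
qed

text \<open>Otherwise the initial segment could be extended by one index, against the maximality of
  \<open>k_val\<close>.\<close>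

lemma first_open_not_in_K_set:
  assumes "first_open n ob < n"
  shows "first_open n ob \<notin> K_set n ob"
proof
  let ?f = "first_open n ob"
  let ?M = "{-1} \<union> {int x |x. x \<in> S (n - 1) \<and> S x \<subseteq> K_set n ob}"
  assume f: "?f \<in> K_set n ob"
  have "k_val n ob \<in> ?M"
    unfolding k_val_def by (rule Max_in[OF k_val_set_finite]) simp
  then have "{..<?f} \<subseteq> K_set n ob"
    by (auto simp: k_val_eq S_def)
  then have "S ?f \<subseteq> K_set n ob"
    using f by (auto simp: S_def order.order_iff_strict)
  then have "int ?f \<in> ?M" using assms by (auto simp: S_def)
  then have "int ?f \<le> k_val n ob"
    unfolding k_val_def by (rule Max_ge[OF k_val_set_finite])
  then show False by (simp add: k_val_eq)
qed

text \<open>The maximum is attained, and by an actual segment rather than by -1. This provides the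
  guard of the sequential variant, that the preceding object has a decision.\<close>

lemma first_open_pred_in_K_set:
  assumes "0 < first_open n ob"
  shows "first_open n ob - 1 \<in> K_set n ob"
proof -
  have "k_val n ob \<in> {-1} \<union> {int x |x. x \<in> S (n - 1) \<and> S x \<subseteq> K_set n ob}"
    unfolding k_val_def by (rule Max_in[OF k_val_set_finite]) simp
  with assms show ?thesis
    by (auto simp: k_val_eq S_def nat_diff_split)
qed

lemma first_open_cong: "K_set n ob = K_set n ob' \<Longrightarrow> first_open n ob = first_open n ob'"
  by (simp add: first_open_def k_val_def)

lemma in_K_set_iff: "0 < n \<Longrightarrow> k \<in> K_set n ob \<longleftrightarrow> k < n \<and> bcs ob k = Some (BC (Some False))"
  unfolding K_set_def S_def by (auto, metis bc.collapse)

lemma first_open_not_False: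
  assumes "first_open n ob < n"
  shows "bcs ob (first_open n ob) \<noteq> Some (BC (Some False))"
  using first_open_not_in_K_set[OF assms] in_K_set_iff[of n] assms by auto

lemma result_Some:
  "result n (Some ob) =
     (if val ob = Bot \<or> n \<le> first_open n ob then Err
      else if bcs ob (first_open n ob) \<noteq> Some (BC (Some True)) then Bot
      else if proposals ob (first_open n ob) = Bot then Err
      else proposals ob (first_open n ob))"
proof (cases "bcs ob (first_open n ob)")
  case (Some B)
  then show ?thesis by (cases B) (auto simp: result_def k_val_eq)
qed (auto simp: result_def k_val_eq)

text \<open>Of the disjunction over the result only one implication remains, because the object at
  \<open>first_open\<close> cannot hold \<open>False\<close>.\<close>

lemma consistent_Some:
  "consistent n (Some ob) \<longleftrightarrow> val ob \<noteq> Bot \<and> first_open n ob < n \<and>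
     (bcs ob (first_open n ob) = Some (BC (Some True)) \<longrightarrow> proposals ob (first_open n ob) \<noteq> Bot)"
proof (cases "bcs ob (first_open n ob)")
  case (Some B)
  obtain r where "B = BC r" by (cases B)
  with Some first_open_not_False[of n ob] show ?thesis
    by (cases r) (auto simp: consistent_def k_val_eq Let_def)
qed (auto simp: consistent_def k_val_eq Let_def)

text \<open>Each way to violate consistency is a branch in which \<open>result\<close> returns
  \<open>Err\<close>. The converse fails, as a corrupted entry of \<open>proposals\<close> may
  itself be \<open>Err\<close>.\<close>

lemma inconsistent_result: "\<not> consistent n Oopt \<Longrightarrow> result n Oopt = Err"
  by (cases Oopt) (auto simp: consistent_Some result_Some consistent_def[of _ None])

section \<open>Single steps\<close>

text \<open>What no step can undo. Decisions are absent on purpose: \<open>BC_Output\<close> may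
  overwrite a result, and only \<open>bc_spec\<close> restrains this.\<close>

definition later :: "('v, 'd) mvc \<Rightarrow> ('v, 'd) mvc \<Rightarrow> bool" where
  "later ob ob' \<longleftrightarrow> val ob' = val ob \<and> (oneTerm ob \<longrightarrow> oneTerm ob') \<and>
     (txDes ob \<noteq> None \<longrightarrow> txDes ob' \<noteq> None) \<and>
     (\<forall>k. bcs ob k \<noteq> None \<longrightarrow> bcs ob' k \<noteq> None) \<and>
     (\<forall>k. proposals ob k \<noteq> Bot \<longrightarrow> proposals ob' k \<noteq> Bot)"

lemma later_refl [simp]: "later ob ob"
  by (simp add: later_def)

lemma later_trans: "later ob ob' \<Longrightarrow> later ob' ob'' \<Longrightarrow> later ob ob''"
  by (simp add: later_def)

lemma effect_later:
  assumes "obj l = Some ob"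
  shows "\<exists>ob'. obj (effect var n h a l) = Some ob' \<and> later ob ob'"
  using assms
  by (cases a) (auto simp: propose_eff_def deliver_eff_def loop_eff_def bc_output_eff_def later_def
      split: option.split)

lemma bin_call_lt: "bin_call var n l = Some (k, b) \<Longrightarrow> k < n"
  by (auto simp: bin_call_def k_val_eq Let_def split: option.splits variant.splits pc.splits if_splits)

lemma bin_call_inactive:
  "bin_call var n l = Some (k, b) \<Longrightarrow> \<exists>ob. obj l = Some ob \<and> bcs ob k = None"
  by (auto simp: bin_call_def k_val_eq Let_def split: option.splits variant.splits pc.splits if_splits)

text \<open>The two calls need different values of \<open>pc\<close>. This matters since
  \<open>loop_eff\<close> gives precedence to the broadcast.\<close>

lemma bin_call_no_urb_call: "bin_call var n l = Some kb \<Longrightarrow> urb_call h l = None"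
  by (auto simp: bin_call_def urb_call_def Let_def
      split: option.splits variant.splits pc.splits if_splits)

lemma loop_eff_bin_call:
  assumes "bin_call var n l = Some (k, b)"
  shows "\<exists>ob. obj (loop_eff var n h d l) = Some ob \<and> bcs ob k \<noteq> None"
  using bin_call_inactive[OF assms] bin_call_no_urb_call[OF assms, of h] assms
  by (auto simp: loop_eff_def)

text \<open>Proposing and delivery set the descriptor only when they create an object, so the
  broadcast is the only remaining writer.\<close>

lemma effect_txDes:
  assumes "obj l = Some ob" "obj (effect var n h a l) = Some ob'"
    "(\<exists>d. a = Loop i d) \<Longrightarrow> urb_call h l = None" "actor a = i"
  shows "txDes ob' = txDes ob"
  using assms
  by (cases a) (auto simp: propose_eff_def deliver_eff_def loop_eff_def bc_output_eff_def
      split: option.splits if_splits)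

lemma effect_pc: "(\<And>d. a \<noteq> Loop i d) \<Longrightarrow> actor a = i \<Longrightarrow> pc (effect var n h a l) = pc l"
  by (cases a) (auto simp: propose_eff_def deliver_eff_def bc_output_eff_def split: option.splits)

section \<open>Executions\<close>

text \<open>From the point of monotonicity on, the predicate either becomes true once and stays so,
  or is false throughout.\<close>

lemma eventually_constant:
  fixes P :: "nat \<Rightarrow> bool"
  assumes "\<forall>\<^sub>F \<tau> in sequentially. P \<tau> \<longrightarrow> P (Suc \<tau>)"
  shows "\<exists>b. \<forall>\<^sub>F \<tau> in sequentially. P \<tau> = b"
proof -
  obtain T where T: "P \<tau> \<Longrightarrow> P (Suc \<tau>)" if "T \<le> \<tau>" for \<tau>
    using assms by (auto simp: eventually_sequentially)
  show ?thesis
  proof (cases "\<exists>\<tau>\<ge>T. P \<tau>")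
    case True
    then obtain \<tau>0 where \<tau>0: "T \<le> \<tau>0" "P \<tau>0" by blast
    have "P \<tau>" if "\<tau>0 \<le> \<tau>" for \<tau>
      using that by (induction rule: dec_induct) (use \<tau>0 in \<open>auto intro: T\<close>)
    then show ?thesis by (auto simp: eventually_sequentially)
  next
    case False
    then show ?thesis by (auto simp: eventually_sequentially)
  qed
qed

lemma eventually_constant_family:
  fixes P :: "nat \<Rightarrow> nat \<Rightarrow> bool"
  assumes "\<And>k. k < n \<Longrightarrow> \<forall>\<^sub>F \<tau> in sequentially. P k \<tau> \<longrightarrow> P k (Suc \<tau>)"
  shows "\<exists>B. \<forall>\<^sub>F \<tau> in sequentially. \<forall>k<n. P k \<tau> = B k"
proof -
  have "\<forall>k\<in>{..<n}. \<exists>b. \<forall>\<^sub>F \<tau> in sequentially. P k \<tau> = b"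
    using assms by (auto intro!: eventually_constant)
  then obtain B where "\<forall>k\<in>{..<n}. \<forall>\<^sub>F \<tau> in sequentially. P k \<tau> = B k" by metis
  then have "\<forall>\<^sub>F \<tau> in sequentially. \<forall>k\<in>{..<n}. P k \<tau> = B k"
    by (intro eventually_ball_finite) auto
  then show ?thesis by (intro exI[of _ B]) (simp add: Ball_def)
qed

lemma infinite_nat_ge:
  fixes N :: "nat set"
  shows "infinite N \<Longrightarrow> \<exists>x\<ge>m. x \<in> N"
  by (metis finite_nat_set_iff_bounded not_less)

section \<open>Facts valid in every execution\<close>

locale mvc_run =
  fixes st :: "nat \<Rightarrow> ('v, 'd, 'e) sys_state"
    and act :: "nat \<Rightarrow> ('v, 'd) action"
    and hT :: "'e \<Rightarrow> nat \<Rightarrow> 'd \<Rightarrow> bool"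
    and var :: variant
    and n :: nat
  assumes exec: "execution var n hT st act"
begin

lemma loc_Suc:
  "loc (st (Suc \<tau>)) i =
     (if actor (act \<tau>) = i then effect var n (hT (low (st \<tau>)) i) (act \<tau>) (loc (st \<tau>) i)
      else loc (st \<tau>) i)"
  using exec by (auto simp: execution_def step_def)

lemma loc_Suc_Loop:
  "act \<tau> = Loop i d \<Longrightarrow>
     loc (st (Suc \<tau>)) i = loop_eff var n (hT (low (st \<tau>)) i) d (loc (st \<tau>) i)"
  by (simp add: loc_Suc)

lemma O_later:
  assumes "\<tau> \<le> \<tau>'" "O_at st \<tau> i = Some ob"
  shows "\<exists>ob'. O_at st \<tau>' i = Some ob' \<and> later ob ob'"
  using assms(1)
proof (induction rule: dec_induct)
  case base
  then show ?case using assms(2) by simp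
next
  case (step m)
  then obtain ob' where ob': "O_at st m i = Some ob'" "later ob ob'" by blast
  have "\<exists>ob''. O_at st (Suc m) i = Some ob'' \<and> later ob' ob''"
    using effect_later[OF ob'(1)] ob'(1) by (auto simp: loc_Suc)
  then show ?case using ob'(2) later_trans by blast
qed

lemma bc_active_mono: "bc_active st \<tau> i k \<Longrightarrow> \<tau> \<le> \<tau>' \<Longrightarrow> bc_active st \<tau>' i k"
  unfolding bc_active_def using O_later later_def by metis

lemma bin_proposes_bc_active:
  assumes "bin_proposes var n st act \<tau> l k b"
  shows "\<not> bc_active st \<tau> l k" "bc_active st (Suc \<tau>) l k"
  using assms bin_call_inactive[of var n "loc (st \<tau>) l" k b]
    loop_eff_bin_call[of var n "loc (st \<tau>) l" k b]
  by (auto simp: bin_proposes_def bc_active_def loc_Suc_Loop)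

text \<open>A call finds its object inactive and leaves it active for good, so different calls of
  one processor concern different indices below \<open>n\<close>. The cutoff \<open>c\<close> keeps
  the set finite, so that \<open>card\<close> really counts.\<close>

lemma card_bin_proposes: "card {\<tau>. \<tau> < c \<and> (\<exists>k b. bin_proposes var n st act \<tau> l k b)} \<le> n"
proof -
  let ?X = "{\<tau>. \<tau> < c \<and> (\<exists>k b. bin_proposes var n st act \<tau> l k b)}"
  let ?f = "\<lambda>\<tau>. fst (the (bin_call var n (loc (st \<tau>) l)))"
  have f: "?f \<tau> = k" if "bin_proposes var n st act \<tau> l k b" for \<tau> k b
    using that by (auto simp: bin_proposes_def)
  have ne: "?f \<tau> \<noteq> ?f \<tau>'" if "\<tau> < \<tau>'" "\<tau> \<in> ?X" "\<tau>' \<in> ?X" for \<tau> \<tau>'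
  proof -
    from that obtain k b k' b' where p: "bin_proposes var n st act \<tau> l k b"
      and p': "bin_proposes var n st act \<tau>' l k' b'" by blast
    have "bc_active st \<tau>' l k"
      using bin_proposes_bc_active(2)[OF p] \<open>\<tau> < \<tau>'\<close> bc_active_mono by (simp add: Suc_le_eq)
    then show ?thesis using bin_proposes_bc_active(1)[OF p'] f[OF p] f[OF p'] by auto
  qed
  have "inj_on ?f ?X"
    by (rule linorder_inj_onI) (use ne in auto)
  moreover have "?f ` ?X \<subseteq> {..<n}"
    by (auto simp: bin_proposes_def dest: bin_call_lt)
  ultimately have "card ?X \<le> card {..<n}"
    by (intro card_inj_on_le) auto
  then show ?thesis by simp
qed

end

section \<open>A correct processor with an active object\<close>

text \<open>Applied twice: to \<open>j\<close> from time 0, and to any correct processor from a time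
  at which its object is active.\<close>

locale active_run = mvc_run st act hT var n
  for st :: "nat \<Rightarrow> ('v, 'd, 'e) sys_state"
    and act :: "nat \<Rightarrow> ('v, 'd) action"
    and hT :: "'e \<Rightarrow> nat \<Rightarrow> 'd \<Rightarrow> bool"
    and var :: variant
    and n :: nat +
  fixes i :: nat and \<tau>0 :: nat and ob0 :: "('v, 'd) mvc"
  assumes fair: "fair_loops n st act"
    and urb: "urb_spec n hT st act"
    and bc: "bc_spec var n st act"
    and correct: "i \<in> Correct n st"
    and active0: "O_at st \<tau>0 i = Some ob0"
begin

lemma i_lt: "i < n"
  using correct by (simp add: Correct_def)

definition ob :: "nat \<Rightarrow> ('v, 'd) mvc" where
  "ob \<tau> = the (O_at st \<tau> i)"

lemma O_ob: "\<tau>0 \<le> \<tau> \<Longrightarrow> O_at st \<tau> i = Some (ob \<tau>)"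
  using O_later[OF _ active0, of \<tau>] by (auto simp: ob_def)

lemma later_ob: "\<tau>0 \<le> \<tau> \<Longrightarrow> \<tau> \<le> \<tau>' \<Longrightarrow> later (ob \<tau>) (ob \<tau>')"
  using O_later[OF _ O_ob, of \<tau> \<tau>'] O_ob[of \<tau>'] by auto

text \<open>The case distinction on a corrupted \<open>val\<close> can therefore be made once, at
  \<open>\<tau>0\<close>.\<close>

lemma val_ob: "\<tau>0 \<le> \<tau> \<Longrightarrow> val (ob \<tau>) = val ob0"
  using later_ob[of \<tau>0 \<tau>] active0 by (simp add: later_def ob_def)

section \<open>Progress of the do-forever loop\<close>

text \<open>Take the first loop step at or after \<tau>: it exists by fairness, and no other kind of
  step changes \<open>pc\<close>.\<close>

lemma next_loop: "\<exists>\<tau>'\<ge>\<tau>. \<exists>d. act \<tau>' = Loop i d \<and> pc (loc (st \<tau>') i) = pc (loc (st \<tau>) i)"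
proof -
  let ?P = "\<lambda>\<tau>'. \<tau> \<le> \<tau>' \<and> (\<exists>d. act \<tau>' = Loop i d)"
  have "\<exists>\<tau>'. ?P \<tau>'"
    using fair correct infinite_nat_ge[of "{\<tau>. \<exists>d. act \<tau> = Loop i d}" \<tau>]
    by (auto simp: fair_loops_def)
  then have least: "?P (LEAST \<tau>'. ?P \<tau>')" by (rule LeastI_ex)
  have "pc (loc (st \<tau>') i) = pc (loc (st \<tau>) i)" if "\<tau> \<le> \<tau>'" "\<tau>' \<le> (LEAST \<tau>'. ?P \<tau>')" for \<tau>'
    using that
  proof (induction rule: dec_induct)
    case (step m)
    then have "act m \<noteq> Loop i d" for d
      using not_less_Least[of m ?P] by auto
    then show ?case using step effect_pc[of "act m" i] by (auto simp: loc_Suc)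
  qed simp
  with least show ?thesis by blast
qed

lemma loop_step:
  assumes "\<tau>0 \<le> \<tau>"
  shows "\<exists>\<tau>'\<ge>\<tau>. \<exists>d. act \<tau>' = Loop i d \<and> pc (loc (st \<tau>') i) = pc (loc (st \<tau>) i) \<and>
    pc (loc (st (Suc \<tau>')) i) = next_pc var n (loc (st \<tau>') i)"
  using next_loop[of \<tau>] by (fastforce simp: loc_Suc_Loop loop_eff_def)

lemma foreach_exit:
  assumes "\<tau>0 \<le> \<tau>" "pc (loc (st \<tau>) i) = ForEach k"
  shows "\<exists>\<tau>'\<ge>\<tau>. pc (loc (st \<tau>') i) = Line1"
  using assms
proof (induction "n - k" arbitrary: k \<tau> rule: less_induct)
  case less
  obtain \<tau>' where \<tau>': "\<tau> \<le> \<tau>'" "pc (loc (st \<tau>') i) = ForEach k"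
    "pc (loc (st (Suc \<tau>')) i) = next_pc var n (loc (st \<tau>') i)"
    using loop_step[OF less.prems(1)] less.prems(2) by auto
  \<comment> \<open>The negative case includes a corrupted \<open>pc\<close>, such as a for-each
    point in the sequential variant; the next step leaves the loop at once.\<close>
  show ?case
  proof (cases "var = Concurrent \<and> k < n")
    case True
    then have "pc (loc (st (Suc \<tau>')) i) = ForEach (Suc k)"
      using \<tau>' O_ob[of \<tau>'] less.prems by (simp add: next_pc_def)
    then obtain \<tau>'' where "Suc \<tau>' \<le> \<tau>''" "pc (loc (st \<tau>'') i) = Line1"
      using less.hyps[of "Suc k" "Suc \<tau>'"] True less.prems \<tau>'(1)
      by (metis diff_less_mono2 le_SucI le_trans lessI)
    then show ?thesis using \<tau>'(1) by (auto intro!: exI[of _ \<tau>''])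
  next
    case False
    then have "pc (loc (st (Suc \<tau>')) i) = Line1"
      using \<tau>' O_ob[of \<tau>'] less.prems by (auto simp: next_pc_def)
    then show ?thesis using \<tau>'(1) by (auto intro!: exI[of _ "Suc \<tau>'"])
  qed
qed

lemma line1_reached:
  assumes "\<tau>0 \<le> \<tau>"
  shows "\<exists>\<tau>'\<ge>\<tau>. pc (loc (st \<tau>') i) = Line1"
proof (cases "pc (loc (st \<tau>) i)")
  case Line1
  then show ?thesis by blast
next
  case Line2
  then obtain \<tau>' where \<tau>': "\<tau> \<le> \<tau>'" "pc (loc (st \<tau>') i) = Line2"
    "pc (loc (st (Suc \<tau>')) i) = next_pc var n (loc (st \<tau>') i)"
    using loop_step[OF assms] by auto
  then have "pc (loc (st (Suc \<tau>')) i) = Line1 \<or> pc (loc (st (Suc \<tau>')) i) = ForEach 0"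
    using O_ob[of \<tau>'] assms by (auto simp: next_pc_def)
  then show ?thesis
    using foreach_exit[of "Suc \<tau>'" 0] assms \<tau>'(1) by (metis le_SucI le_trans)
next
  case (ForEach k)
  then show ?thesis using foreach_exit assms by blast
qed

lemma line1_step:
  assumes "\<tau>0 \<le> \<tau>"
  shows "\<exists>\<tau>'\<ge>\<tau>. \<exists>d. act \<tau>' = Loop i d \<and> pc (loc (st \<tau>') i) = Line1"
  using line1_reached[OF assms] next_loop by (metis le_trans)

lemma line2_step:
  assumes "\<tau>0 \<le> \<tau>"
  shows "\<exists>\<tau>'\<ge>\<tau>. \<exists>d. act \<tau>' = Loop i d \<and> pc (loc (st \<tau>') i) = Line2"
proof -
  obtain \<tau>1 where \<tau>1: "\<tau> \<le> \<tau>1" "pc (loc (st \<tau>1) i) = Line1"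
    using line1_reached[OF assms] by blast
  then obtain \<tau>2 where \<tau>2: "\<tau>1 \<le> \<tau>2" "pc (loc (st \<tau>2) i) = Line1"
    "pc (loc (st (Suc \<tau>2)) i) = next_pc var n (loc (st \<tau>2) i)"
    using loop_step[of \<tau>1] assms by auto
  then have "pc (loc (st (Suc \<tau>2)) i) = Line2"
    using O_ob[of \<tau>2] assms \<tau>1 by (simp add: next_pc_def)
  then show ?thesis
    using next_loop[of "Suc \<tau>2"] \<tau>1(1) \<tau>2(1) by (metis le_SucI le_trans)
qed

lemma foreach_step:
  assumes "var = Concurrent" "\<tau>0 \<le> \<tau>" "pc (loc (st \<tau>) i) = ForEach 0" "k \<le> n"
  shows "\<exists>\<tau>'\<ge>\<tau>. \<exists>d. act \<tau>' = Loop i d \<and> pc (loc (st \<tau>') i) = ForEach k"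
  using assms(4)
proof (induction k)
  case 0
  then show ?case using next_loop[of \<tau>] assms(3) by auto
next
  case (Suc k)
  then obtain \<tau>1 d where \<tau>1: "\<tau> \<le> \<tau>1" "act \<tau>1 = Loop i d" "pc (loc (st \<tau>1) i) = ForEach k" by auto
  then have "pc (loc (st (Suc \<tau>1)) i) = ForEach (Suc k)"
    using O_ob[of \<tau>1] assms(1,2) Suc.prems by (simp add: loc_Suc_Loop loop_eff_def next_pc_def)
  then show ?case
    using next_loop[of "Suc \<tau>1"] \<tau>1(1) by (metis le_SucI le_trans)
qed

section \<open>Broadcasts and the flag \<open>oneTerm\<close>\<close>

text \<open>Without further broadcasts the descriptor would freeze. If it is \<open>None\<close>,
  the guard of line (1) holds; otherwise \<open>hasTerminated\<close> becomes and stays true of it,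
  even if it is corrupted. Either way a later visit to line (1) broadcasts.\<close>

lemma broadcasts_again:
  assumes "val ob0 \<noteq> Bot"
  shows "\<exists>\<tau>'\<ge>\<tau>. \<exists>d. urb_broadcasts hT st act \<tau>' i d (val ob0)"
proof (rule ccontr)
  assume "\<not> ?thesis"
  then have none: "\<not> urb_broadcasts hT st act \<tau>' i d (val ob0)" if "\<tau> \<le> \<tau>'" for \<tau>' d
    using that by blast
  obtain T where
    keep: "\<forall>\<tau>\<ge>T. \<forall>i<n. \<forall>ob d. O_at st \<tau> i = Some ob \<and> txDes ob = Some d \<and> has_term hT st \<tau> i d \<and>
        (\<nexists>d' v. urb_broadcasts hT st act \<tau> i d' v) \<longrightarrow> has_term hT st (Suc \<tau>) i d" and
    final: "\<forall>\<tau>\<ge>T. \<forall>i\<in>Correct n st. \<forall>ob d. O_at st \<tau> i = Some ob \<and> txDes ob = Some d \<longrightarrow>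
        (\<exists>\<tau>'\<ge>\<tau>. has_term hT st \<tau>' i d)"
    using urb unfolding urb_spec_def by (elim exE conjE) (rule that)
  define s where "s = max (max \<tau> T) \<tau>0"
  have s: "\<tau> \<le> s" "T \<le> s" "\<tau>0 \<le> s" by (auto simp: s_def)
  \<comment> \<open>The assumption excludes only broadcasts of \<open>val ob0\<close>, but no other
    value can be broadcast, since \<open>val\<close> never changes.\<close>
  have urb_None: "urb_call (hT (low (st \<tau>')) i) (loc (st \<tau>') i) = None"
    if "s \<le> \<tau>'" "act \<tau>' = Loop i d" for \<tau>' d
    using none[of \<tau>' d] that s O_ob[of \<tau>'] val_ob[of \<tau>']
    by (auto simp: urb_broadcasts_def urb_call_def split: if_splits)
  have tx: "txDes (ob \<tau>') = txDes (ob s)" if "s \<le> \<tau>'" for \<tau>'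
    using that
  proof (induction rule: dec_induct)
    case (step m)
    have "txDes (ob (Suc m)) = txDes (ob m)"
      using effect_txDes[OF O_ob[of m], of var n "hT (low (st m)) i" "act m" "ob (Suc m)" i]
        O_ob[of "Suc m"] O_ob[of m] step(1) s urb_None[of m]
      by (fastforce simp: loc_Suc split: if_splits)
    then show ?case using step by simp
  qed simp
  show False
  proof (cases "txDes (ob s)")
    case None
    obtain \<tau>' d where "s \<le> \<tau>'" "act \<tau>' = Loop i d" "pc (loc (st \<tau>') i) = Line1"
      using line1_step s by blast
    then show False
      using urb_None[of \<tau>' d] tx[of \<tau>'] None O_ob[of \<tau>'] val_ob[of \<tau>'] assms s
      by (simp add: urb_call_def)
  next
    case (Some d)
    obtain s' where s': "s \<le> s'" "has_term hT st s' i d"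
      using final[rule_format, of s i "ob s" d] Some O_ob[of s] s correct by auto
    \<comment> \<open>Persistence bridges the gap between \<open>s'\<close> and the next visit to
      line (1).\<close>
    have ht: "has_term hT st \<tau>' i d" if "s' \<le> \<tau>'" for \<tau>'
      using that
    proof (induction rule: dec_induct)
      case (step m)
      have "\<nexists>d' v. urb_broadcasts hT st act m i d' v"
        using urb_None[of m] step(1) s'(1) by (auto simp: urb_broadcasts_def)
      then show ?case
        using keep[rule_format, of m i "ob m" d] step s s'(1) O_ob[of m] tx[of m] Some i_lt by auto
    qed (use s' in simp)
    obtain \<tau>' d' where "s' \<le> \<tau>'" "act \<tau>' = Loop i d'" "pc (loc (st \<tau>') i) = Line1"
      using line1_step[of s'] s s'(1) by auto
    then show False
      using urb_None[of \<tau>' d'] tx[of \<tau>'] Some O_ob[of \<tau>'] val_ob[of \<tau>'] assms s s'(1) ht[of \<tau>']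
      by (simp add: urb_call_def has_term_def)
  qed
qed

text \<open>Two broadcasts suffice. After the first, \<open>txDes\<close> is no longer
  \<open>None\<close>, so the second can occur only when \<open>hasTerminated\<close> holds, and
  then it sets the flag.\<close>

lemma oneTerm_eventually:
  assumes "val ob0 \<noteq> Bot"
  shows "\<exists>\<tau>1\<ge>\<tau>0. \<forall>\<tau>\<ge>\<tau>1. oneTerm (ob \<tau>)"
proof -
  obtain \<tau>1 d where \<tau>1: "\<tau>0 \<le> \<tau>1" "urb_broadcasts hT st act \<tau>1 i d (val ob0)"
    using broadcasts_again[OF assms] by blast
  obtain \<tau>2 d' where \<tau>2: "Suc \<tau>1 \<le> \<tau>2" "urb_broadcasts hT st act \<tau>2 i d' (val ob0)"
    using broadcasts_again[OF assms] by blast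
  have "txDes (ob (Suc \<tau>1)) = Some d"
    using \<tau>1 O_ob[of \<tau>1]
    by (simp add: ob_def[of "Suc \<tau>1"] urb_broadcasts_def loc_Suc_Loop loop_eff_def)
  \<comment> \<open>\<open>d''\<close> may differ from \<open>d\<close>, as other broadcasts can
    occur in between.\<close>
  then obtain d'' where "txDes (ob \<tau>2) = Some d''"
    using later_ob[of "Suc \<tau>1" \<tau>2] \<tau>1(1) \<tau>2(1) by (auto simp: later_def)
  then have "oneTerm (ob (Suc \<tau>2))"
    using \<tau>2 \<tau>1(1) O_ob[of \<tau>2]
    by (auto simp: ob_def[of "Suc \<tau>2"] urb_broadcasts_def loc_Suc_Loop loop_eff_def urb_call_def split: if_splits)
  then have "oneTerm (ob \<tau>)" if "Suc \<tau>2 \<le> \<tau>" for \<tau>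
    using later_ob[of "Suc \<tau>2" \<tau>] that \<tau>1(1) \<tau>2(1) by (auto simp: later_def)
  then show ?thesis using \<tau>1(1) \<tau>2(1) by (intro exI[of _ "Suc \<tau>2"]) auto
qed

section \<open>Activation of binary consensus objects\<close>

lemma bin_call_active:
  assumes "act \<tau> = Loop i d" "bin_call var n (loc (st \<tau>) i) = Some (k, b)"
  shows "bcs (ob (Suc \<tau>)) k \<noteq> None"
  using loop_eff_bin_call[OF assms(2), of "hT (low (st \<tau>)) i" d] assms(1)
  by (auto simp: ob_def loc_Suc_Loop)

text \<open>
  The sequential variant activates the object \<open>m\<close> only while \<open>m\<close> is the first open index, so
  that index has to be constant; the concurrent variant activates all objects.
\<close>

lemma first_open_activated:
  assumes "val ob0 \<noteq> Bot" "\<And>\<tau>. c \<le> \<tau> \<Longrightarrow> first_open n (ob \<tau>) = m" "m < n"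
  shows "\<exists>\<tau>\<ge>\<tau>0. bcs (ob \<tau>) m \<noteq> None"
proof -
  obtain \<tau>1 where \<tau>1: "\<tau>0 \<le> \<tau>1" "\<And>\<tau>. \<tau>1 \<le> \<tau> \<Longrightarrow> oneTerm (ob \<tau>)"
    using oneTerm_eventually[OF assms(1)] by blast
  \<comment> \<open>A visit to line (2) late enough for both \<open>oneTerm\<close> and the
    constancy of \<open>first_open\<close>.\<close>
  obtain \<tau>2 d where \<tau>2: "max \<tau>1 c \<le> \<tau>2" "act \<tau>2 = Loop i d" "pc (loc (st \<tau>2) i) = Line2"
    using line2_step[of "max \<tau>1 c"] \<tau>1(1) by (metis max.coboundedI1)
  then have le: "\<tau>0 \<le> \<tau>2" "\<tau>1 \<le> \<tau>2" "c \<le> \<tau>2" using \<tau>1(1) by auto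
  show ?thesis
  proof (cases "bcs (ob \<tau>2) m = None")
    case True
    show ?thesis
    proof (cases var)
      case Sequential
      \<comment> \<open>The disjuncts match those of the guard: \<open>m = 0\<close> is
        \<open>k = -1\<close>, and otherwise the preceding object has a decision.\<close>
      have "m = 0 \<or> bcs (ob \<tau>2) (m - 1) = Some (BC (Some False))"
        using first_open_pred_in_K_set[of n "ob \<tau>2"] in_K_set_iff[of n] assms(2)[of \<tau>2] le assms(3)
        by auto
      moreover have nat_pred: "nat (int m - 1) = m - 1" by arith
      ultimately have "bin_call var n (loc (st \<tau>2) i) = Some (m, proposals (ob \<tau>2) m \<noteq> Bot)"
        using True Sequential \<tau>2(3) \<tau>1(2)[of \<tau>2] O_ob[of \<tau>2] le assms(2)[of \<tau>2] assms(3)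
        by (auto simp: bin_call_def k_val_eq nat_pred)
      then show ?thesis using bin_call_active[OF \<tau>2(2)] le(1) by (intro exI[of _ "Suc \<tau>2"]) auto
    next
      case Concurrent
      \<comment> \<open>Object \<open>m\<close> itself witnesses the guard that some object is
        inactive.\<close>
      then have "pc (loc (st (Suc \<tau>2)) i) = ForEach 0"
        using \<tau>2 True \<tau>1(2)[of \<tau>2] O_ob[of \<tau>2] le assms(3)
        by (auto simp: loc_Suc_Loop loop_eff_def next_pc_def)
      then obtain \<tau>3 d' where \<tau>3: "Suc \<tau>2 \<le> \<tau>3" "act \<tau>3 = Loop i d'" "pc (loc (st \<tau>3) i) = ForEach m"
        using foreach_step[OF Concurrent, of "Suc \<tau>2" m] le assms(3) by auto
      show ?thesis
      proof (cases "bcs (ob \<tau>3) m = None")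
        case True
        then have "bin_call var n (loc (st \<tau>3) i) = Some (m, proposals (ob \<tau>3) m \<noteq> Bot)"
          using Concurrent \<tau>3 O_ob[of \<tau>3] le assms(3) by (auto simp: bin_call_def)
        then show ?thesis
          using bin_call_active[OF \<tau>3(2)] le(1) \<tau>3(1) by (intro exI[of _ "Suc \<tau>3"]) auto
      qed (use \<tau>3 le in \<open>auto intro!: exI[of _ \<tau>3]\<close>)
    qed
  qed (use le in blast)
qed

section \<open>Limit behaviour of the object\<close>

lemma bc_decided_iff:
  "\<tau>0 \<le> \<tau> \<Longrightarrow> bc_decided st \<tau> i k b \<longleftrightarrow> bcs (ob \<tau>) k = Some (BC (Some b))"
  using O_ob[of \<tau>] by (auto simp: bc_decided_def) (metis bc.collapse)

text \<open>The termination clause also covers objects left active by the fault, so it does not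
  matter how the object became active.\<close>

lemma decision_reached:
  assumes "k < n" "bc_active st \<tau> i k"
  shows "\<exists>\<tau>'\<ge>\<tau>. \<exists>b. bc_decided st \<tau>' i k b"
proof -
  have "\<forall>\<tau>. \<forall>i\<in>Correct n st. bc_active st \<tau> i k \<longrightarrow> (\<exists>\<tau>'\<ge>\<tau>. \<exists>b. bc_decided st \<tau>' i k b)"
    using bc[unfolded bc_spec_def, THEN spec, THEN mp, OF assms(1)] by (elim conjE)
  then show ?thesis using correct assms(2) by simp
qed

text \<open>Corrupted objects may revise decisions for a while; integrity from some point on makes
  the predicate monotone eventually.\<close>

lemma decisions_eventually_constant:
  "\<exists>D. \<forall>\<^sub>F \<tau> in sequentially. \<forall>k<n. (bcs (ob \<tau>) k = Some (BC (Some b))) = D k"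
proof (rule eventually_constant_family)
  fix k assume "k < n"
  then obtain T where "\<forall>\<tau>\<ge>T. \<forall>i<n. \<forall>b. bc_decided st \<tau> i k b \<longrightarrow> bc_decided st (Suc \<tau>) i k b"
    using bc unfolding bc_spec_def by blast
  then have "bcs (ob (Suc \<tau>)) k = Some (BC (Some b))"
    if "max T \<tau>0 \<le> \<tau>" "bcs (ob \<tau>) k = Some (BC (Some b))" for \<tau>
    using that i_lt bc_decided_iff[of \<tau> k b] bc_decided_iff[of "Suc \<tau>" k b] by simp
  then show "\<forall>\<^sub>F \<tau> in sequentially. bcs (ob \<tau>) k = Some (BC (Some b)) \<longrightarrow>
      bcs (ob (Suc \<tau>)) k = Some (BC (Some b))"
    unfolding eventually_sequentially by blast
qed

lemma proposals_eventually_constant: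
  "\<exists>P. \<forall>\<^sub>F \<tau> in sequentially. \<forall>k<n. (proposals (ob \<tau>) k \<noteq> Bot) = P k"
proof (rule eventually_constant_family)
  fix k
  have "proposals (ob (Suc \<tau>)) k \<noteq> Bot" if "\<tau>0 \<le> \<tau>" "proposals (ob \<tau>) k \<noteq> Bot" for \<tau>
    using later_ob[of \<tau> "Suc \<tau>"] that by (simp add: later_def)
  then show "\<forall>\<^sub>F \<tau> in sequentially. proposals (ob \<tau>) k \<noteq> Bot \<longrightarrow> proposals (ob (Suc \<tau>)) k \<noteq> Bot"
    unfolding eventually_sequentially by blast
qed

text \<open>Let \<open>m\<close> be the limit of \<open>first_open\<close>. If \<open>val\<close> is
  not \<open>Bot\<close> and \<open>m < n\<close>, object \<open>m\<close> becomes active and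
  decides. The decision is not \<open>False\<close>, as \<open>m\<close> would then not be open. So
  from \<open>c\<close> on \<open>result\<close> is \<open>Err\<close> or a proposal.\<close>

lemma stabilization:
  "\<exists>c\<ge>\<tau>0. \<forall>\<tau>\<ge>c. result n (O_at st \<tau> i) \<noteq> Bot \<and>
     consistent n (O_at st \<tau> i) = consistent n (O_at st c i)"
proof -
  obtain F where "\<forall>\<^sub>F \<tau> in sequentially. \<forall>k<n. (bcs (ob \<tau>) k = Some (BC (Some False))) = F k"
    using decisions_eventually_constant[of False] by blast
  moreover obtain D where
    "\<forall>\<^sub>F \<tau> in sequentially. \<forall>k<n. (bcs (ob \<tau>) k = Some (BC (Some True))) = D k"
    using decisions_eventually_constant[of True] by blast
  moreover obtain P where "\<forall>\<^sub>F \<tau> in sequentially. \<forall>k<n. (proposals (ob \<tau>) k \<noteq> Bot) = P k"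
    using proposals_eventually_constant by blast
  ultimately have "\<forall>\<^sub>F \<tau> in sequentially. \<forall>k<n. (bcs (ob \<tau>) k = Some (BC (Some False))) = F k \<and>
      (bcs (ob \<tau>) k = Some (BC (Some True))) = D k \<and> (proposals (ob \<tau>) k \<noteq> Bot) = P k"
    by eventually_elim simp
  then obtain c' where "\<forall>\<tau>\<ge>c'. \<forall>k<n. (bcs (ob \<tau>) k = Some (BC (Some False))) = F k \<and>
      (bcs (ob \<tau>) k = Some (BC (Some True))) = D k \<and> (proposals (ob \<tau>) k \<noteq> Bot) = P k"
    by (auto simp: eventually_sequentially)
  moreover define c where "c = max c' \<tau>0"
  ultimately have c: "\<tau>0 \<le> c"
    and F: "\<And>\<tau> k. c \<le> \<tau> \<Longrightarrow> k < n \<Longrightarrow> bcs (ob \<tau>) k = Some (BC (Some False)) \<longleftrightarrow> F k"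
    and D: "\<And>\<tau> k. c \<le> \<tau> \<Longrightarrow> k < n \<Longrightarrow> bcs (ob \<tau>) k = Some (BC (Some True)) \<longleftrightarrow> D k"
    and P: "\<And>\<tau> k. c \<le> \<tau> \<Longrightarrow> k < n \<Longrightarrow> proposals (ob \<tau>) k \<noteq> Bot \<longleftrightarrow> P k"
    by auto
  have n: "0 < n" using i_lt by simp
  define m where "m = first_open n (ob c)"
  \<comment> \<open>\<open>first_open\<close> depends only on which objects have decided
    \<open>False\<close>, and \<open>F\<close> fixes these.\<close>
  have m: "first_open n (ob \<tau>) = m" if "c \<le> \<tau>" for \<tau>
    unfolding m_def using F[OF that] F[of c]
    by (intro first_open_cong set_eqI) (auto simp: in_K_set_iff[OF n])
  have Dm: "D m" if v: "val ob0 \<noteq> Bot" and lt: "m < n"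
  proof -
    obtain \<tau> where "\<tau>0 \<le> \<tau>" "bcs (ob \<tau>) m \<noteq> None"
      using first_open_activated[OF v m lt] by blast
    then have "bc_active st \<tau> i m" using O_ob by (auto simp: bc_active_def)
    then have "bc_active st (max \<tau> c) i m" using bc_active_mono by simp
    then obtain \<tau>' b where \<tau>': "max \<tau> c \<le> \<tau>'" "bc_decided st \<tau>' i m b"
      using decision_reached[OF lt] by blast
    then have b: "bcs (ob \<tau>') m = Some (BC (Some b))"
      using bc_decided_iff[of \<tau>'] c by simp
    then have "b" using first_open_not_False[of n "ob \<tau>'"] m[of \<tau>'] \<tau>'(1) lt by (cases b) auto
    with b show ?thesis using D[of \<tau>' m] \<tau>'(1) lt by simp
  qed
  have "result n (O_at st \<tau> i) \<noteq> Bot" if "c \<le> \<tau>" for \<tau>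
    using that O_ob[of \<tau>] val_ob[of \<tau>] c m[OF that] D[OF that, of m] Dm by (auto simp: result_Some)
  \<comment> \<open>The right-hand side does not mention \<tau>, so consistency has one truth value
    from \<open>c\<close> on.\<close>
  moreover have "\<not> consistent n (O_at st \<tau> i) \<longleftrightarrow> val ob0 = Bot \<or> n \<le> m \<or> D m \<and> \<not> P m"
    if "c \<le> \<tau>" for \<tau>
    using that O_ob[of \<tau>] val_ob[of \<tau>] c m[OF that] D[OF that, of m] P[OF that, of m]
    by (auto simp: consistent_Some)
  ultimately show ?thesis using c by blast
qed

end

text \<open>If the fault leaves \<open>val\<close> at \<open>j\<close> equal to \<open>Bot\<close>,
  then \<open>j\<close> never broadcasts and \<open>O\<close> may stay inactive at \<open>i\<close>,
  with result \<open>Bot\<close>; hence the second disjunct. The proof distinguishes whether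
  \<open>O\<close> is ever active at \<open>i\<close>.\<close>

theorem theorem6p1:
  fixes st :: "nat \<Rightarrow> ('v, 'd, 'e) sys_state"
    and act :: "nat \<Rightarrow> ('v, 'd) action"
    and hT :: "'e \<Rightarrow> nat \<Rightarrow> 'd \<Rightarrow> bool"
    and var :: variant
    and n t j :: nat
  assumes "execution var n hT st act"
    and "fair_loops n st act"
    and "urb_spec n hT st act"
    and "bc_spec var n st act"
    and "card ({..<n} - Correct n st) \<le> t" and "2 * t < n"
    and "j \<in> Correct n st" and "\<forall>\<tau>. O_at st \<tau> j \<noteq> None"
    and "\<forall>i\<in>Correct n st. infinite {\<tau>. act \<tau> = Result i}"
  shows "\<forall>i\<in>Correct n st. \<exists>c.
    (\<forall>l\<in>Correct n st. card {\<tau>. \<tau> < c \<and> (\<exists>k b. bin_proposes var n st act \<tau> l k b)} \<le> n) \<and>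
    ((\<forall>\<tau>\<ge>c. result n (O_at st \<tau> i) \<noteq> Bot) \<or>
     (\<forall>\<tau>. O_at st \<tau> i = None \<and> val (the (O_at st \<tau> j)) = Bot)) \<and>
    (\<forall>\<tau>\<ge>c. consistent n (O_at st \<tau> i) \<or>
       (\<exists>\<tau>'\<ge>\<tau>. act \<tau>' = Result i \<and> result n (O_at st \<tau>' i) = Err))"
proof
  fix i assume i: "i \<in> Correct n st"
  interpret mvc_run st act hT var n by unfold_locales (rule assms(1))
  show "\<exists>c.
    (\<forall>l\<in>Correct n st. card {\<tau>. \<tau> < c \<and> (\<exists>k b. bin_proposes var n st act \<tau> l k b)} \<le> n) \<and>
    ((\<forall>\<tau>\<ge>c. result n (O_at st \<tau> i) \<noteq> Bot) \<or>
     (\<forall>\<tau>. O_at st \<tau> i = None \<and> val (the (O_at st \<tau> j)) = Bot)) \<and>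
    (\<forall>\<tau>\<ge>c. consistent n (O_at st \<tau> i) \<or>
       (\<exists>\<tau>'\<ge>\<tau>. act \<tau>' = Result i \<and> result n (O_at st \<tau>' i) = Err))"
  proof (cases "\<forall>\<tau>. O_at st \<tau> i = None")
    case True
    obtain obj0 where obj0: "O_at st 0 j = Some obj0" using assms(8) by blast
    interpret J: active_run st act hT var n j 0 obj0
      using assms(1-4,7) obj0 by unfold_locales
    have "val obj0 = Bot"
    proof (rule ccontr)
      assume v: "val obj0 \<noteq> Bot"
      \<comment> \<open>A broadcast of \<open>j\<close> after \<open>T\<close> is delivered at
        \<open>i\<close>, and the delivery activates \<open>O\<close> there.\<close>
      obtain T where "\<forall>\<tau>\<ge>T. \<forall>j\<in>Correct n st. \<forall>d v. urb_broadcasts hT st act \<tau> j d v \<longrightarrow>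
          (\<forall>i\<in>Correct n st. \<exists>\<tau>'>\<tau>. act \<tau>' = Deliver i j d v)"
        using assms(3) unfolding urb_spec_def by (elim exE conjE) (rule that)
      then obtain \<tau> d where "act \<tau> = Deliver i j d (val obj0)"
        using J.broadcasts_again[OF v, of T] assms(7) i by blast
      then have "O_at st (Suc \<tau>) i \<noteq> None"
        using v by (auto simp: loc_Suc deliver_eff_def split: option.split)
      then show False using True by simp
    qed
    then have "val (the (O_at st \<tau> j)) = Bot" for \<tau>
      using J.val_ob[of \<tau>] by (simp add: J.ob_def)
    \<comment> \<open>Any \<open>c\<close> is a witness here, since an inactive object is
      consistent.\<close>
    then show ?thesis using True card_bin_proposes by (auto simp: consistent_def)
  next
    case False
    then obtain \<tau>0 ob0 where "O_at st \<tau>0 i = Some ob0" by auto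
    then interpret I: active_run st act hT var n i \<tau>0 ob0
      using assms(1-4) i by unfold_locales
    obtain c where c: "\<And>\<tau>. c \<le> \<tau> \<Longrightarrow> result n (O_at st \<tau> i) \<noteq> Bot"
      "\<And>\<tau>. c \<le> \<tau> \<Longrightarrow> consistent n (O_at st \<tau> i) = consistent n (O_at st c i)"
      using I.stabilization by blast
    have "\<exists>\<tau>'\<ge>\<tau>. act \<tau>' = Result i \<and> result n (O_at st \<tau>' i) = Err"
      if "c \<le> \<tau>" "\<not> consistent n (O_at st \<tau> i)" for \<tau>
    proof -
      \<comment> \<open>Consistency is constant from \<open>c\<close> on, so the inconsistency lasts
        until the next call of \<open>result\<close>, which reports it.\<close>
      obtain \<tau>' where "\<tau> \<le> \<tau>'" "act \<tau>' = Result i"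
        using assms(9) i infinite_nat_ge[of "{\<tau>. act \<tau> = Result i}" \<tau>] by auto
      moreover from this that have "result n (O_at st \<tau>' i) = Err"
        using c(2)[of \<tau>] c(2)[of \<tau>'] by (intro inconsistent_result) auto
      ultimately show ?thesis by blast
    qed
    then show ?thesis using c(1) card_bin_proposes by blast
  qed
qed

end
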